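(* For every measure $\mu \in \mathcal{M}$ there exists a de Branges space $\mathcal{H}$ that is isometrically isomorphic to $\ell^2(\mu)$, where the class $\mathcal{M}$, de Branges spaces, and the phrase "isometrically isomorphic to $\ell^2(\mu)$" are as defined in the context.
   Context: A Hilbert space of entire functions is a complex vector space of entire functions $\mathbb{C} \to \mathbb{C}$ (with pointwise operations) equipped with an inner product making it a Hilbert space. For an entire function $F$ put $F^*(z) = \overline{F(\bar z)}$. Consider the following properties of a Hilbert space of entire functions: (H1) Whenever $F$ is in the space and has a non-real zero $w$, the function $z \mapsto F(z)(z - \bar w)(z - w)^{-1}$ (extended analytically to $z = w$) belongs to the space and has the same norm as $F$. (H2) For every complex number $w$, the linear functional defined on the space by $F \mapsto F(w)$ is continuous. (H3) Whenever $F$ is in the space, the function $F^*$ belongs to the space and has the same norm as $F$. A de Branges space is a Hilbert space of entire functions, different from $\{0\}$, that satisfies (H1), (H2) and (H3). $\mathcal{M}$ is the set of all Borel measures $\mu$ supported on infinite discrete (i.e. having no finite accumulation points) subsets of the real line. For $\mu \in \mathcal{M}$, $\{t_i\}_{i \in \mathbb{N}}$ denotes an enumeration of $\operatorname{supp}\mu$ (without repetitions) and $\mu_n = \mu(\{t_n\})$ the mass of $\mu$ at $t_n$, with $0 < \mu_n < \infty$. $\ell^2(\mu)$ is the Hilbert space of complex sequences $v = \{v_i\}_{i \in \mathbb{N}}$ with $\|v\|^2_{\ell^2(\mu)} = \sum_n \mu_n |v_n|^2 < +\infty$. A Hilbert space of entire functions $\mathcal{H}$ is called isometrically isomorphic to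 $\ell^2(\mu)$, where $\mu \in \mathcal{M}$, if $\|F\|^2_{\mathcal{H}} = \sum_n \mu_n |F(t_n)|^2$ for all $F \in \mathcal{H}$ and the map $F \mapsto \{F(t_i)\}_{i \in \mathbb{N}}$ is a bijection of $\mathcal{H}$ onto $\ell^2(\mu)$. *)

theory Defs
  imports "HOL-Complex_Analysis.Complex_Analysis"
begin

definition ip_norm :: "('f \<Rightarrow> 'f \<Rightarrow> complex) \<Rightarrow> 'f \<Rightarrow> real" where
  "ip_norm ip F = sqrt (Re (ip F F))"

text \<open>The inner product is linear in its first argument. Only its values on \<open>H\<close> are constrained.\<close>

locale entire_inner_product_space =
  fixes H :: "(complex \<Rightarrow> complex) set"
    and ip :: "(complex \<Rightarrow> complex) \<Rightarrow> (complex \<Rightarrow> complex) \<Rightarrow> complex"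
  assumes entire: "F \<in> H \<Longrightarrow> F holomorphic_on UNIV"
    and zero_mem: "(\<lambda>z. 0) \<in> H"
    and add_mem: "\<lbrakk>F \<in> H; G \<in> H\<rbrakk> \<Longrightarrow> (\<lambda>z. F z + G z) \<in> H"
    and scale_mem: "F \<in> H \<Longrightarrow> (\<lambda>z. c * F z) \<in> H"
    and ip_add_left: "\<lbrakk>F \<in> H; G \<in> H; K \<in> H\<rbrakk> \<Longrightarrow> ip (\<lambda>z. F z + G z) K = ip F K + ip G K"
    and ip_scale_left: "\<lbrakk>F \<in> H; G \<in> H\<rbrakk> \<Longrightarrow> ip (\<lambda>z. c * F z) G = c * ip F G"
    and ip_commute: "\<lbrakk>F \<in> H; G \<in> H\<rbrakk> \<Longrightarrow> ip G F = cnj (ip F G)"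
    and ip_nonneg: "F \<in> H \<Longrightarrow> 0 \<le> Re (ip F F)"
    and ip_definite: "\<lbrakk>F \<in> H; ip F F = 0\<rbrakk> \<Longrightarrow> F = (\<lambda>z. 0)"
begin

text \<open>The distance is set to \<open>0\<close> outside \<open>H\<close> because \<^locale>\<open>Metric_space\<close> requires
  symmetry and non-negativity on the whole type.\<close>

definition hdist :: "(complex \<Rightarrow> complex) \<Rightarrow> (complex \<Rightarrow> complex) \<Rightarrow> real" where
  "hdist F G = (if F \<in> H \<and> G \<in> H then ip_norm ip (\<lambda>z. F z - G z) else 0)"

lemma diff_mem: "\<lbrakk>F \<in> H; G \<in> H\<rbrakk> \<Longrightarrow> (\<lambda>z. F z - G z) \<in> H"
  using add_mem[of F "\<lambda>z. (-1) * G z"] scale_mem[of G "-1"] by simp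

lemma ip_add_right:
  assumes "F \<in> H" "G \<in> H" "K \<in> H"
  shows "ip K (\<lambda>z. F z + G z) = ip K F + ip K G"
  using assms ip_add_left[of F G K] ip_commute[of "\<lambda>z. F z + G z" K]
    ip_commute[of F K] ip_commute[of G K] add_mem by simp

lemma ip_scale_right:
  assumes "F \<in> H" "G \<in> H"
  shows "ip G (\<lambda>z. c * F z) = cnj c * ip G F"
  using assms ip_scale_left[of F G c] ip_commute[of "\<lambda>z. c * F z" G]
    ip_commute[of F G] scale_mem by simp

lemma ip_self_real: "F \<in> H \<Longrightarrow> ip F F = of_real (Re (ip F F))"
  using ip_commute[of F F] by (simp add: complex_eq_iff)

lemma ip_norm_scale:
  assumes "F \<in> H"
  shows "ip_norm ip (\<lambda>z. c * F z) = cmod c * ip_norm ip F"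
proof -
  have "ip (\<lambda>z. c * F z) (\<lambda>z. c * F z) = (c * cnj c) * ip F F"
    using assms scale_mem by (simp add: ip_scale_left ip_scale_right)
  also have "\<dots> = of_real ((cmod c)\<^sup>2 * Re (ip F F))"
    using ip_self_real[OF assms] by (metis complex_norm_square of_real_mult)
  finally show ?thesis
    by (simp add: ip_norm_def real_sqrt_mult)
qed

lemma ip_norm_eq_0: "\<lbrakk>F \<in> H; ip_norm ip F = 0\<rbrakk> \<Longrightarrow> F = (\<lambda>z. 0)"
  using ip_self_real[of F] ip_definite[of F] by (simp add: ip_norm_def)

lemma ip_norm_nonneg: "F \<in> H \<Longrightarrow> 0 \<le> ip_norm ip F"
  by (simp add: ip_norm_def ip_nonneg)

lemma ip_norm_sq: "F \<in> H \<Longrightarrow> (ip_norm ip F)\<^sup>2 = Re (ip F F)"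
  by (simp add: ip_norm_def ip_nonneg)

lemma ip_norm_add_sq:
  assumes "F \<in> H" "G \<in> H"
  shows "(ip_norm ip (\<lambda>z. F z + G z))\<^sup>2 = (ip_norm ip F)\<^sup>2 + 2 * Re (ip F G) + (ip_norm ip G)\<^sup>2"
  using assms ip_commute[of F G] add_mem
  by (simp add: ip_norm_sq ip_add_left ip_add_right)

lemma Re_ip_le:
  assumes F: "F \<in> H" and G: "G \<in> H"
  shows "Re (ip F G) \<le> ip_norm ip F * ip_norm ip G"
proof (cases "G = (\<lambda>z. 0)")
  case True
  have "ip F (\<lambda>z. 0 * G z) = cnj 0 * ip F G"
    by (rule ip_scale_right[OF G F])
  then show ?thesis
    using True ip_norm_nonneg F G by simp
next
  case False
  define a b where "a = ip_norm ip F" and "b = ip_norm ip G"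
  have b: "b > 0" and a: "a \<ge> 0"
    using False ip_norm_eq_0[OF G] ip_norm_nonneg G F unfolding a_def b_def by force+
  define x y where "x = (\<lambda>z. complex_of_real b * F z)" and "y = (\<lambda>z. complex_of_real (-a) * G z)"
  have xy: "x \<in> H" "y \<in> H"
    unfolding x_def y_def using scale_mem F G by blast+
  have "Re (ip x y) = - (a * b * Re (ip F G))"
    unfolding y_def ip_scale_right[OF G xy(1)] unfolding x_def ip_scale_left[OF F G] by simp
  moreover have "ip_norm ip x = b * a" "ip_norm ip y = a * b"
    unfolding x_def y_def ip_norm_scale[OF F] ip_norm_scale[OF G] using a b
    by (simp_all add: a_def b_def)
  ultimately have *: "a * b * Re (ip F G) \<le> (a * b) * (a * b)"
    using ip_norm_add_sq[OF xy] zero_le_power2[of "ip_norm ip (\<lambda>z. x z + y z)"]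
    by (simp add: power2_eq_square mult_ac)
  show ?thesis
  proof (cases "a = 0")
    case True
    then have "F = (\<lambda>z. 0)"
      using ip_norm_eq_0[OF F] a_def by simp
    then show ?thesis
      using ip_scale_left[OF F G, of 0] True by (simp add: a_def)
  next
    case False
    then have "a * b > 0"
      using a b by simp
    then show ?thesis
      using * mult_le_cancel_left_pos a_def b_def by blast
  qed
qed

lemma ip_norm_triangle:
  assumes "F \<in> H" "G \<in> H"
  shows "ip_norm ip (\<lambda>z. F z + G z) \<le> ip_norm ip F + ip_norm ip G"
proof (rule power2_le_imp_le)
  show "(ip_norm ip (\<lambda>z. F z + G z))\<^sup>2 \<le> (ip_norm ip F + ip_norm ip G)\<^sup>2"
    using ip_norm_add_sq[OF assms] Re_ip_le[OF assms] by (simp add: power2_sum)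
qed (simp add: assms ip_norm_nonneg)

lemma hdist_metric: "Metric_space H hdist"
proof
  show "0 \<le> hdist F G" for F G
    by (simp add: hdist_def diff_mem ip_norm_nonneg)
  show "hdist F G = hdist G F" for F G
    using ip_norm_scale[of "\<lambda>z. F z - G z" "-1"] diff_mem[of F G] by (simp add: hdist_def)
  show "hdist F G = 0 \<longleftrightarrow> F = G" if "F \<in> H" "G \<in> H" for F G
  proof
    assume "hdist F G = 0"
    then show "F = G"
      using ip_norm_eq_0[OF diff_mem[OF that]] that by (auto simp: hdist_def fun_eq_iff)
  next
    assume "F = G"
    then show "hdist F G = 0"
      using ip_norm_scale[OF that(1), of 0] by (simp add: hdist_def)
  qed
  show "hdist F K \<le> hdist F G + hdist G K" if "F \<in> H" "G \<in> H" "K \<in> H" for F G K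
    using ip_norm_triangle[OF diff_mem[of F G] diff_mem[of G K]] that by (simp add: hdist_def)
qed

sublocale hmetric: Metric_space H hdist
  by (rule hdist_metric)

end

locale entire_hilbert_space = entire_inner_product_space +
  assumes complete: "hmetric.mcomplete"

text \<open>\<^const>\<open>remove_sings\<close> provides the analytic extension to \<open>z = w\<close> in \<open>H1\<close>.\<close>

locale de_branges_space = entire_hilbert_space +
  assumes nontrivial: "H \<noteq> {\<lambda>z. 0}"
    and H1: "\<lbrakk>F \<in> H; Im w \<noteq> 0; F w = 0\<rbrakk> \<Longrightarrow>
        remove_sings (\<lambda>z. F z * (z - cnj w) / (z - w)) \<in> H \<and>
        ip_norm ip (remove_sings (\<lambda>z. F z * (z - cnj w) / (z - w))) = ip_norm ip F"
    and H2: "continuous_map hmetric.mtopology euclidean (\<lambda>F. F w)"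
    and H3: "F \<in> H \<Longrightarrow>
        (\<lambda>z. cnj (F (cnj z))) \<in> H \<and> ip_norm ip (\<lambda>z. cnj (F (cnj z))) = ip_norm ip F"

lemma remove_sings_blaschke:
  assumes "F holomorphic_on UNIV" "F w = 0"
  shows "remove_sings (\<lambda>z. F z * (z - cnj w) / (z - w)) holomorphic_on UNIV"
    and "z \<noteq> w \<Longrightarrow> remove_sings (\<lambda>z. F z * (z - cnj w) / (z - w)) z = F z * (z - cnj w) / (z - w)"
proof -
  let ?f = "\<lambda>z. F z * (z - cnj w) / (z - w)"
  have an: "?f analytic_on {z}" if "z \<noteq> w" for z
    using holomorphic_on_imp_analytic_at[OF assms(1)] that by (intro analytic_intros) auto
  then show eq: "remove_sings ?f z = ?f z" if "z \<noteq> w" for z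
    using that by (intro remove_sings_at_analytic) auto
  define g where "g = (\<lambda>z. (if z = w then deriv F w else (F z - F w) / (z - w)) * (z - cnj w))"
  have hol: "g holomorphic_on UNIV"
    unfolding g_def using pole_lemma_open[OF assms(1) open_UNIV, of w]
    by (intro holomorphic_on_mult holomorphic_intros)
  have "?f \<midarrow>w\<rightarrow> g w"
  proof (rule Lim_transform_eventually)
    show "g \<midarrow>w\<rightarrow> g w"
      using hol holomorphic_on_imp_continuous_on[OF hol] by (simp add: continuous_on_def)
    show "\<forall>\<^sub>F z in at w. g z = ?f z"
      using assms(2) by (auto simp: eventually_at_filter g_def)
  qed
  then have "remove_sings ?f w = g w"
    by (rule remove_sings_eqI)
  then have "remove_sings ?f = g"
    using eq assms(2) by (auto simp: g_def fun_eq_iff)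
  then show "remove_sings ?f holomorphic_on UNIV"
    using hol by simp
qed

definition msupport :: "real measure \<Rightarrow> real set" where
  "msupport \<mu> = {x. \<forall>U. open U \<and> x \<in> U \<longrightarrow> emeasure \<mu> U > 0}"

definition discrete_measures :: "real measure set" where
  "discrete_measures = {\<mu>. sets \<mu> = sets borel \<and> infinite (msupport \<mu>) \<and>
     (\<forall>x. \<not> x islimpt msupport \<mu>) \<and>
     (\<forall>x\<in>msupport \<mu>. 0 < emeasure \<mu> {x} \<and> emeasure \<mu> {x} < \<infinity>)}"

definition enumerates_support :: "(nat \<Rightarrow> real) \<Rightarrow> real measure \<Rightarrow> bool" where
  "enumerates_support t \<mu> \<longleftrightarrow> bij_betw t UNIV (msupport \<mu>)"

text \<open>A Borel measure on the line is automatically concentrated on its support, so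
  \<open>discrete_measures\<close> need not require it.\<close>

lemma emeasure_compl_msupport:
  assumes "sets \<mu> = sets borel"
  shows "emeasure \<mu> (- msupport \<mu>) = 0"
proof -
  let ?N = "{U :: real set. open U \<and> emeasure \<mu> U = 0}"
  obtain N' where N': "N' \<subseteq> ?N" "countable N'" "\<Union> N' = \<Union> ?N"
    using Lindelof[of ?N] by blast
  have "\<Union> ?N = - msupport \<mu>"
    by (auto simp: msupport_def not_gr_zero)
  moreover have "(\<Union>U\<in>N'. U) \<in> null_sets \<mu>"
    using N' assms by (intro null_sets_UN') (auto simp: null_sets_def)
  ultimately show ?thesis
    using N' by (simp add: null_sets_def)
qed

lemma ex_enumerates_support:
  assumes "\<mu> \<in> discrete_measures"
  shows "\<exists>t. enumerates_support t \<mu>"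
proof -
  have "msupport \<mu> sparse_in UNIV"
    using assms by (auto simp: discrete_measures_def sparse_in_def)
  then have "countable (msupport \<mu>)"
    using sparse_imp_countable[OF open_UNIV] by simp
  then show ?thesis
    using assms bij_betw_from_nat_into[of "msupport \<mu>"]
    by (auto simp: discrete_measures_def enumerates_support_def)
qed

definition ell2 :: "(nat \<Rightarrow> real) \<Rightarrow> (nat \<Rightarrow> complex) set" where
  "ell2 m = {v. summable (\<lambda>n. m n * (cmod (v n))\<^sup>2)}"

text \<open>The condition does not depend on the enumeration \<open>t\<close>. Quantifying over all of them is
  not vacuous for measures in \<open>discrete_measures\<close>, by \<open>ex_enumerates_support\<close>.\<close>

definition isometric_to_ell2 ::
    "(complex \<Rightarrow> complex) set \<Rightarrow> ((complex \<Rightarrow> complex) \<Rightarrow> (complex \<Rightarrow> complex) \<Rightarrow> complex) \<Rightarrow>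
     real measure \<Rightarrow> bool" where
  "isometric_to_ell2 H ip \<mu> \<longleftrightarrow>
     (\<forall>t. enumerates_support t \<mu> \<longrightarrow>
        (\<forall>F\<in>H. (\<lambda>n. measure \<mu> {t n} * (cmod (F (of_real (t n))))\<^sup>2) sums (ip_norm ip F)\<^sup>2) \<and>
        bij_betw (\<lambda>F n. F (of_real (t n))) H (ell2 (\<lambda>n. measure \<mu> {t n})))"

end

theory Submission
  imports Defs
begin

text \<open>
  Take an entire function \<open>S\<close>, real on the real line, with simple zeros exactly at the points
  \<open>t\<^sub>n\<close>, and with \<open>\<bar>S'(t\<^sub>n)\<bar>\<close> so large that \<open>\<Sum> 1 / (\<mu>\<^sub>n S'(t\<^sub>n)\<^sup>2)\<close> converges: a Weierstrass product
  times \<open>exp G\<close>, where \<open>G\<close> is a real entire function that grows fast along the sequence. By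
  Cauchy--Schwarz the Lagrange series \<open>F\<^sub>v(z) = \<Sum> v\<^sub>n S(z) / (S'(t\<^sub>n) (z - t\<^sub>n))\<close> then converges locally
  uniformly for every \<open>v\<close> in \<open>\<ell>\<^sup>2(\<mu>)\<close>, and it interpolates \<open>v\<close>. The functions \<open>F\<^sub>v\<close>, with the norm of \<open>v\<close>, form
  the space: (H3) holds since \<open>S\<close> is real, and (H1) since, when \<open>F\<^sub>v(w) = 0\<close>, multiplying \<open>F\<^sub>v\<close> by
  the Blaschke quotient amounts to multiplying each \<open>v\<^sub>n\<close> by its unimodular value at \<open>t\<^sub>n\<close>.
\<close>

section \<open>Locally uniformly convergent series of entire functions\<close>

text \<open>The M-test on the disc of radius \<open>norm z + 1\<close>, which contains the closed
  unit disc around \<open>z\<close>, gives the uniform convergence near \<open>z\<close> that makes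
  the limit holomorphic. The majorant is only required eventually, because the estimates used later
  fail for finitely many terms on a given disc.\<close>

lemma holomorphic_on_suminf:
  fixes f :: "nat \<Rightarrow> complex \<Rightarrow> complex"
  assumes hol: "\<And>n. f n holomorphic_on UNIV"
    and bound: "\<And>R. R > 0 \<Longrightarrow> \<exists>M. summable M \<and> (\<forall>\<^sub>F n in sequentially. \<forall>z\<in>cball 0 R. norm (f n z) \<le> M n)"
  shows "(\<lambda>z. \<Sum>n. f n z) holomorphic_on UNIV"
proof (rule holomorphic_uniform_sequence[OF open_UNIV])
  show "(\<lambda>z. \<Sum>n<N. f n z) holomorphic_on UNIV" for N
    by (intro holomorphic_intros hol)
  fix z :: complex
  obtain M where "summable M"
    and M: "\<forall>\<^sub>F n in sequentially. \<forall>x\<in>cball 0 (norm z + 1). norm (f n x) \<le> M n"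
    using bound[of "norm z + 1"] by (meson norm_ge_zero add_nonneg_pos zero_less_one)
  then have "uniform_limit (cball 0 (norm z + 1)) (\<lambda>N x. \<Sum>n<N. f n x) (\<lambda>x. \<Sum>n. f n x) sequentially"
    by (intro Weierstrass_m_test_ev) auto
  then have "uniform_limit (cball z 1) (\<lambda>N x. \<Sum>n<N. f n x) (\<lambda>x. \<Sum>n. f n x) sequentially"
    by (rule uniform_limit_on_subset) (simp add: cball_subset_cball_iff)
  then show "\<exists>d>0. cball z d \<subseteq> UNIV \<and>
      uniform_limit (cball z d) (\<lambda>N x. \<Sum>n<N. f n x) (\<lambda>x. \<Sum>n. f n x) sequentially"
    by (intro exI[of _ 1]) auto
qed

lemma summable_of_locally_bounded:
  fixes f :: "nat \<Rightarrow> complex \<Rightarrow> complex"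
  assumes "\<And>R. R > 0 \<Longrightarrow> \<exists>M. summable M \<and> (\<forall>\<^sub>F n in sequentially. \<forall>z\<in>cball 0 R. norm (f n z) \<le> M n)"
  shows "summable (\<lambda>n. f n z)"
proof -
  obtain M where "summable M"
    and M: "\<forall>\<^sub>F n in sequentially. \<forall>x\<in>cball 0 (norm z + 1). norm (f n x) \<le> M n"
    using assms[of "norm z + 1"] by (meson norm_ge_zero add_nonneg_pos zero_less_one)
  show ?thesis
    by (rule summable_comparison_test_ev[OF _ \<open>summable M\<close>]) (use M in \<open>auto elim!: eventually_mono\<close>)
qed

lemma cnj_suminf:
  assumes "summable f"
  shows "cnj (\<Sum>n. f n) = (\<Sum>n. cnj (f n))"
  using bounded_linear.suminf[OF bounded_linear_cnj assms] by simp

section \<open>Entire functions of prescribed growth along a sequence\<close>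

text \<open>The function is a series of monomials in \<open>z / a n\<close>. On each disc this
  quotient is eventually at most 1/2 in modulus, so suitable exponents outweigh the coefficients,
  however fast \<open>b\<close> grows.\<close>

lemma entire_function_dominating_sequence:
  fixes a b :: "nat \<Rightarrow> real"
  assumes nz: "\<And>n. a n \<noteq> 0" and lim: "filterlim a at_infinity sequentially"
  obtains G :: "complex \<Rightarrow> complex" where "G holomorphic_on UNIV"
    "\<And>z. G (cnj z) = cnj (G z)" "\<And>n. b n \<le> Re (G (of_real (a n)))"
proof -
  define b' where "b' n = max 0 (b n)" for n
  \<comment> \<open>The exponent has two tasks: \<open>2 ^ k n\<close> absorbs the coefficient
    \<open>b' n\<close>, and \<open>n \<le> k n\<close> makes the remaining factor
    \<open>(1/2) ^ k n\<close> summable.\<close>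
  have "\<exists>k. n \<le> k \<and> b' n \<le> 2 ^ k" for n
  proof -
    obtain j where "b' n < 2 ^ j"
      using real_arch_pow[of 2 "b' n"] by auto
    moreover have "(2::real) ^ j \<le> 2 ^ max n j"
      by (intro power_increasing) auto
    ultimately show ?thesis
      by (intro exI[of _ "max n j"]) linarith
  qed
  then obtain k where k: "\<And>n. n \<le> k n" "\<And>n. b' n \<le> 2 ^ k n"
    by metis
  \<comment> \<open>The even exponents make all terms non-negative on the real line, so at \<open>a n\<close> the \<open>n\<close>-th
    term alone gives the bound.\<close>
  define g where "g n z = of_real (b' n) * (z / of_real (a n)) ^ (2 * k n)" for n and z :: complex
  have g_bound: "\<exists>M. summable M \<and> (\<forall>\<^sub>F n in sequentially. \<forall>z\<in>cball 0 R. norm (g n z) \<le> M n)"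
    if "R > 0" for R
  proof (intro exI conjI)
    show "summable (\<lambda>n. (1/2::real) ^ n)"
      by (rule summable_geometric) auto
    have "\<forall>\<^sub>F n in sequentially. 2 * R \<le> \<bar>a n\<bar>"
      using filterlim_at_infinity_imp_norm_at_top[OF lim] by (simp add: filterlim_at_top)
    then show "\<forall>\<^sub>F n in sequentially. \<forall>z\<in>cball 0 R. norm (g n z) \<le> (1/2) ^ n"
    proof eventually_elim
      case (elim n)
      show ?case
      proof
        fix z :: complex assume "z \<in> cball 0 R"
        then have "norm z / \<bar>a n\<bar> \<le> 1 / 2"
          using elim nz[of n] by (simp add: field_simps)
        then have "(norm z / \<bar>a n\<bar>) ^ (2 * k n) \<le> (1 / 2) ^ (2 * k n)"
          by (intro power_mono) auto
        then have "norm (g n z) \<le> 2 ^ k n * (1 / 2) ^ (2 * k n)"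
          unfolding g_def norm_mult norm_power norm_divide norm_of_real
          by (intro mult_mono) (use k(2)[of n] in \<open>auto simp: b'_def\<close>)
        also have "\<dots> = (1 / 2) ^ k n"
          by (simp add: power_mult power2_eq_square power_mult_distrib power_divide field_simps)
        also have "\<dots> \<le> (1 / 2) ^ n"
          by (intro power_decreasing k) auto
        finally show "norm (g n z) \<le> (1/2) ^ n" .
      qed
    qed
  qed
  note summable_g = summable_of_locally_bounded[OF g_bound]
  show ?thesis
  proof
    show "(\<lambda>z. \<Sum>n. g n z) holomorphic_on UNIV"
      by (rule holomorphic_on_suminf[OF _ g_bound]) (auto simp: g_def nz intro!: holomorphic_intros)
    show "(\<Sum>n. g n (cnj z)) = cnj (\<Sum>n. g n z)" for z
    proof -
      have "g n (cnj z) = cnj (g n z)" for n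
        by (simp add: g_def)
      then show ?thesis
        by (simp only: cnj_suminf[OF summable_g])
    qed
    fix n
    define h where "h i = b' i * (a n / a i) ^ (2 * k i)" for i
    have gh: "g i (of_real (a n)) = of_real (h i)" for i
      by (simp add: g_def h_def)
    have "summable h"
      using summable_g[of "of_real (a n)"] unfolding gh by (simp only: summable_complex_of_real)
    moreover have "h i \<ge> 0" for i
      unfolding h_def by (simp add: b'_def power_mult)
    ultimately have "sum h {n} \<le> suminf h"
      by (intro sum_le_suminf) auto
    moreover have "h n \<ge> b n"
      using nz[of n] by (simp add: h_def b'_def)
    ultimately show "b n \<le> Re (\<Sum>i. g i (of_real (a n)))"
      by (simp add: gh suminf_of_real[OF \<open>summable h\<close>, symmetric])
  qed
qed

section \<open>Real entire functions with prescribed simple zeros\<close>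

text \<open>Near a zero of order one, \<open>f x = g x * (x - z)\<close> with
  \<open>g z \<noteq> 0\<close>, and the product rule gives \<open>deriv f z = g z\<close>. The
  point \<open>w\<close> excludes the zero function, which admits no such factorisation.\<close>

lemma deriv_nonzero_of_zorder_eq_1:
  assumes hol: "f holomorphic_on UNIV" and "f z = 0" "zorder f z = 1" "f w \<noteq> 0"
  shows "deriv f z \<noteq> 0"
proof -
  obtain r where r: "r > 0" "zor_poly f z holomorphic_on cball z r"
      "\<forall>x\<in>cball z r. f x = zor_poly f z x * (x - z) \<and> zor_poly f z x \<noteq> 0"
    using zorder_exist_zero[OF hol open_UNIV connected_UNIV UNIV_I, of z] assms by auto
  let ?g = "zor_poly f z"
  have "?g holomorphic_on ball z r"
    using r(2) ball_subset_cball by (rule holomorphic_on_subset)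
  then have "(?g has_field_derivative deriv ?g z) (at z)"
    using r(1) by (intro holomorphic_derivI[of _ "ball z r"]) auto
  then have "((\<lambda>x. ?g x * (x - z)) has_field_derivative ?g z) (at z)"
    by (auto intro!: derivative_eq_intros)
  then have "(f has_field_derivative ?g z) (at z)"
    by (rule DERIV_cong_ev[THEN iffD1, rotated -1])
       (use r eventually_nhds_in_open[of "ball z r" z] in \<open>auto elim!: eventually_mono\<close>)
  then show ?thesis
    using r by (simp add: DERIV_imp_deriv)
qed

text \<open>By Bolzano-Weierstrass a bounded set without limit points is finite, so every bounded
  interval contains finitely many terms; injectivity turns this into finitely many indices.\<close>

lemma filterlim_at_infinity_of_no_limit_points:
  fixes t :: "nat \<Rightarrow> real"
  assumes "inj t" "\<And>x. \<not> x islimpt range t"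
  shows "filterlim t at_infinity sequentially"
  unfolding filterlim_at_infinity_conv_norm_at_top filterlim_at_top
proof
  fix C :: real
  have "finite (range t \<inter> cball 0 C)"
    using assms(2) compact_cball[of "0::real" C] islimpt_subset
    by (metis compact_eq_Bolzano_Weierstrass inf.cobounded1 inf.cobounded2)
  then have "finite {n. \<bar>t n\<bar> \<le> C}"
    by (rule inj_on_finite[rotated 2, where f = t]) (use assms(1) in \<open>auto simp: inj_on_def\<close>)
  then show "\<forall>\<^sub>F n in sequentially. C \<le> norm (t n)"
    by (simp add: cofinite_eq_sequentially[symmetric] eventually_cofinite not_le less_imp_le)
       (rule finite_subset[rotated], auto)
qed

text \<open>Injectivity of \<open>a\<close> gives each zero of the Weierstrass product order one.
  The product is real on the real line because its zeros are real: the partial products commute with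
  conjugation, and so does their limit.\<close>

lemma real_weierstrass_function:
  fixes a :: "nat \<Rightarrow> real"
  assumes inj: "inj a" and nz: "\<And>n. a n \<noteq> 0" and lim: "filterlim a at_infinity sequentially"
  obtains f where "f holomorphic_on UNIV" "\<And>z. f (cnj z) = cnj (f z)"
    "\<And>z. f z = 0 \<longleftrightarrow> z \<in> range (\<lambda>n. complex_of_real (a n))"
    "\<And>n. deriv f (of_real (a n)) \<noteq> 0"
proof -
  interpret W: weierstrass_product' "\<lambda>n. complex_of_real (a n)"
  proof
    show "filterlim (\<lambda>n. complex_of_real (a n)) at_infinity sequentially"
      using filterlim_at_infinity_imp_norm_at_top[OF lim]
      by (simp add: filterlim_at_infinity_conv_norm_at_top)
    show "finite ((\<lambda>n. complex_of_real (a n)) -` {z})" for z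
      by (rule finite_vimageI) (use inj in \<open>auto simp: inj_def\<close>)
  qed (use nz in auto)
  have vimage: "(\<lambda>i. complex_of_real (a i)) -` {of_real (a n)} = {n}" for n
    using inj by (auto simp: inj_def)
  have "range (\<lambda>n. complex_of_real (a n)) \<noteq> UNIV"
    using complex_is_Real_iff[of \<i>] by (metis Reals_of_real UNIV_I imageE imaginary_unit.sel(2) one_neq_zero)
  then obtain w where w: "W.f w \<noteq> 0"
    using W.zero by blast
  show ?thesis
  proof
    show "W.f holomorphic_on UNIV"
      by (rule W.holomorphic)
    show "W.f z = 0 \<longleftrightarrow> z \<in> range (\<lambda>n. complex_of_real (a n))" for z
      by (rule W.zero)
    show "deriv W.f (of_real (a n)) \<noteq> 0" for n
      by (rule deriv_nonzero_of_zorder_eq_1[OF W.holomorphic _ _ w])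
         (auto simp: W.zero W.zorder vimage)
    show "W.f (cnj z) = cnj (W.f z)" for z
    proof (rule LIMSEQ_unique)
      let ?P = "\<lambda>z N. \<Prod>n\<le>N. weierstrass_factor n (z / complex_of_real (a n))"
      have P: "?P z \<longlonglongrightarrow> W.f z" for z
        unfolding W.f_def by (rule convergent_prod_LIMSEQ[OF W.convergent])
      show "?P (cnj z) \<longlonglongrightarrow> W.f (cnj z)"
        by (rule P)
      have "?P (cnj z) = (\<lambda>N. cnj (?P z N))"
        by (simp add: weierstrass_factor_def exp_cnj)
      then show "?P (cnj z) \<longlonglongrightarrow> cnj (W.f z)"
        using tendsto_cnj[OF P, of z] by simp
    qed
  qed
qed


section \<open>Generating functions for the interpolation nodes\<close>

text \<open>The assumption \<open>summable_S\<close> says that the sequence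
  \<open>1 / deriv S (t n)\<close> is square-summable with the dual weights \<open>1 / m n\<close>.
  Cauchy-Schwarz can then pair it with every element of \<open>ell2 m\<close>.\<close>

locale sampling =
  fixes t m :: "nat \<Rightarrow> real" and S :: "complex \<Rightarrow> complex"
  assumes inj_t: "inj t"
    and lim_t: "filterlim t at_infinity sequentially"
    and m_pos: "m n > 0"
    and S_hol: "S holomorphic_on UNIV"
    and S_cnj: "S (cnj z) = cnj (S z)"
    and S_zero: "S z = 0 \<longleftrightarrow> z \<in> range (\<lambda>n. complex_of_real (t n))"
    and deriv_S: "deriv S (of_real (t n)) \<noteq> 0"
    and summable_S: "summable (\<lambda>n. 1 / (m n * (cmod (deriv S (of_real (t n))))\<^sup>2))"

text \<open>Multiplying a Weierstrass product by \<open>exp G\<close> with \<open>G\<close> real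
  preserves its zeros and its reality, but multiplies the derivative at a zero by the value of
  \<open>exp G\<close> there, which can be made arbitrarily large.\<close>

lemma real_generating_function:
  fixes t m :: "nat \<Rightarrow> real"
  assumes inj: "inj t" and lim: "filterlim t at_infinity sequentially"
    and pos: "\<And>n. m n > 0"
  obtains S where "sampling t m S"
proof -
  \<comment> \<open>Weierstrass factors need nonzero zeros, so the sequence is shifted by a real \<open>c\<close> that it omits.\<close>
  have "range t \<noteq> UNIV"
    using uncountable_UNIV_real by (metis countableI_type countable_image)
  then obtain c where c: "c \<notin> range t"
    by blast
  define a where "a n = t n - c" for n
  have a: "inj a" "\<And>n. a n \<noteq> 0"
    using inj c by (auto simp: a_def inj_def)
  have lima: "filterlim a at_infinity sequentially"
    unfolding a_def using tendsto_add_filterlim_at_infinity'[OF lim tendsto_const[of "- c"]] by simp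
  obtain f where f: "f holomorphic_on UNIV" "\<And>z. f (cnj z) = cnj (f z)"
    "\<And>z. f z = 0 \<longleftrightarrow> z \<in> range (\<lambda>n. complex_of_real (a n))"
    "\<And>n. deriv f (of_real (a n)) \<noteq> 0"
    using real_weierstrass_function[OF a lima] by blast
  \<comment> \<open>This is the size that the square of \<open>exp (Re (G (a n)))\<close> must reach
    for the \<open>n\<close>-th term of \<open>summable_S\<close> to be at most
    \<open>1 / 2 ^ n\<close>. The bound \<open>b n \<le> Re (G (a n))\<close> suffices because
    \<open>b n \<le> exp (b n)\<close>.\<close>
  define b where "b n = 2 ^ n / (m n * (cmod (deriv f (of_real (a n))))\<^sup>2)" for n
  obtain G where G: "G holomorphic_on UNIV" "\<And>z. G (cnj z) = cnj (G z)"
    "\<And>n. b n \<le> Re (G (of_real (a n)))"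
    using entire_function_dominating_sequence[OF a(2) lima, where b = b] by blast
  have b0: "b n \<ge> 0" for n
    using pos[of n] by (simp add: b_def)
  define S where "S z = f (z - of_real c) * exp (G (z - of_real c))" for z
  \<comment> \<open>In the product rule the summand with \<open>deriv G\<close> carries the factor
    \<open>f (a n) = 0\<close>.\<close>
  have deriv_S: "deriv S (of_real (t n)) = deriv f (of_real (a n)) * exp (G (of_real (a n)))" for n
  proof -
    have "((\<lambda>w. f w * exp (G w)) has_field_derivative
        deriv f (of_real (a n)) * exp (G (of_real (a n)))) (at (of_real (a n)))"
    proof -
      have "(f has_field_derivative deriv f (of_real (a n))) (at (of_real (a n)))"
        "(G has_field_derivative deriv G (of_real (a n))) (at (of_real (a n)))"
        using f(1) G(1) by (auto intro!: holomorphic_derivI)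
      moreover have "f (of_real (a n)) = 0"
        using f(3) by blast
      ultimately show ?thesis
        by (auto intro!: derivative_eq_intros)
    qed
    then have "((\<lambda>w. f (w - of_real c) * exp (G (w - of_real c))) has_field_derivative
        deriv f (of_real (a n)) * exp (G (of_real (a n)))) (at (of_real (t n)))"
      using DERIV_shift[of "\<lambda>w. f w * exp (G w)" _ "of_real (t n)" "- of_real c"] by (simp add: a_def)
    then show ?thesis
      unfolding S_def by (rule DERIV_imp_deriv)
  qed
  show ?thesis
  proof (rule that, unfold_locales)
    have shift: "(\<lambda>z. h (z - of_real c)) holomorphic_on UNIV" if "h holomorphic_on UNIV" for h
      by (rule holomorphic_on_compose_gen[OF _ that, of "\<lambda>z. z - of_real c" UNIV, unfolded o_def])
         (auto intro!: holomorphic_intros)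
    show "S holomorphic_on UNIV"
      unfolding S_def by (intro holomorphic_intros shift f G)
    show "S (cnj z) = cnj (S z)" for z
      using f(2)[of "z - of_real c"] G(2)[of "z - of_real c"] by (simp add: S_def exp_cnj)
    show "S z = 0 \<longleftrightarrow> z \<in> range (\<lambda>n. complex_of_real (t n))" for z
      by (auto simp: S_def f(3) a_def image_iff algebra_simps)
    show "deriv S (of_real (t n)) \<noteq> 0" for n
      using f(4) by (simp add: deriv_S)
    show "summable (\<lambda>n. 1 / (m n * (cmod (deriv S (of_real (t n))))\<^sup>2))"
    proof (rule summable_comparison_test')
      show "summable (\<lambda>n. (1/2::real) ^ n)"
        by (rule summable_geometric) auto
      fix n
      define d where "d = m n * (cmod (deriv f (of_real (a n))))\<^sup>2"
      have d: "d > 0"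
        using pos[of n] f(4)[of n] by (simp add: d_def)
      have "b n \<le> exp (b n)"
        using exp_ge_add_one_self[of "b n"] by linarith
      also have "\<dots> \<le> exp (2 * Re (G (of_real (a n))))"
        using G(3)[of n] b0[of n] by simp
      also have "\<dots> = (exp (Re (G (of_real (a n)))))\<^sup>2"
        by (simp add: exp_double)
      finally have "2 ^ n \<le> d * (exp (Re (G (of_real (a n)))))\<^sup>2"
        using d by (simp add: b_def d_def[symmetric] field_simps)
      also have "\<dots> = m n * (cmod (deriv S (of_real (t n))))\<^sup>2"
        by (simp add: deriv_S d_def norm_mult power_mult_distrib)
      finally have "1 / (m n * (cmod (deriv S (of_real (t n))))\<^sup>2) \<le> 1 / 2 ^ n"
        by (intro divide_left_mono) (auto intro!: mult_pos_pos pos simp: deriv_S f(4))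
      then show "norm (1 / (m n * (cmod (deriv S (of_real (t n))))\<^sup>2)) \<le> (1/2) ^ n"
        using pos[of n] by (simp add: power_divide)
    qed
  qed (rule inj lim pos)+
qed

section \<open>Weighted square-summable sequences\<close>

lemma ell2_lincomb:
  assumes "\<And>n. m n > 0" "v \<in> ell2 m" "u \<in> ell2 m"
  shows "(\<lambda>n. a * v n + b * u n) \<in> ell2 m"
proof -
  have "summable (\<lambda>n. 2 * (cmod a)\<^sup>2 * (m n * (cmod (v n))\<^sup>2) + 2 * (cmod b)\<^sup>2 * (m n * (cmod (u n))\<^sup>2))"
    using assms(2,3) by (intro summable_add summable_mult) (auto simp: ell2_def)
  moreover have "norm (m n * (cmod (a * v n + b * u n))\<^sup>2) \<le>
      2 * (cmod a)\<^sup>2 * (m n * (cmod (v n))\<^sup>2) + 2 * (cmod b)\<^sup>2 * (m n * (cmod (u n))\<^sup>2)" for n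
  proof -
    have "(cmod (a * v n + b * u n))\<^sup>2 \<le> (cmod a * cmod (v n) + cmod b * cmod (u n))\<^sup>2"
      using norm_triangle_ineq[of "a * v n" "b * u n"] by (intro power_mono) (auto simp: norm_mult)
    also have "\<dots> \<le> 2 * (cmod a)\<^sup>2 * (cmod (v n))\<^sup>2 + 2 * (cmod b)\<^sup>2 * (cmod (u n))\<^sup>2"
      using zero_le_power2[of "cmod a * cmod (v n) - cmod b * cmod (u n)"]
      by (simp add: power2_sum power2_diff power_mult_distrib)
    finally have "m n * (cmod (a * v n + b * u n))\<^sup>2 \<le>
        m n * (2 * (cmod a)\<^sup>2 * (cmod (v n))\<^sup>2 + 2 * (cmod b)\<^sup>2 * (cmod (u n))\<^sup>2)"
      using assms(1)[of n] by (intro mult_left_mono) auto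
    then show ?thesis
      using assms(1)[of n] by (simp add: algebra_simps)
  qed
  ultimately show ?thesis
    unfolding ell2_def by (auto intro: summable_comparison_test')
qed

lemma ell2_summable_inner:
  assumes pos: "\<And>n. m n > 0" and "v \<in> ell2 m" "u \<in> ell2 m"
  shows "summable (\<lambda>n. of_real (m n) * (v n * cnj (u n)))"
proof (rule summable_comparison_test')
  show "summable (\<lambda>n. m n * (cmod (v n))\<^sup>2 + m n * (cmod (u n))\<^sup>2)"
    using assms(2,3) by (intro summable_add) (auto simp: ell2_def)
  show "cmod (of_real (m n) * (v n * cnj (u n))) \<le> m n * (cmod (v n))\<^sup>2 + m n * (cmod (u n))\<^sup>2" for n
  proof -
    have "2 * (cmod (v n) * cmod (u n)) \<le> (cmod (v n))\<^sup>2 + (cmod (u n))\<^sup>2"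
      using zero_le_power2[of "cmod (v n) - cmod (u n)"] by (simp add: power2_diff)
    then have "cmod (v n) * cmod (u n) \<le> (cmod (v n))\<^sup>2 + (cmod (u n))\<^sup>2"
      using zero_le_power2[of "cmod (v n)"] zero_le_power2[of "cmod (u n)"] by linarith
    then show ?thesis
      using pos[of n] by (simp add: norm_mult flip: distrib_left)
  qed
qed

text \<open>The splitting of \<open>v n * k n\<close> into \<open>sqrt (m n) * v n\<close> and
  \<open>k n / sqrt (m n)\<close> reduces the claim to finite sums. The resulting bound is uniform
  in the number of terms, so it yields convergence as well.\<close>

lemma ell2_Cauchy_Schwarz:
  assumes pos: "\<And>n. m n > 0" and v: "v \<in> ell2 m" and k: "summable (\<lambda>n. (cmod (k n))\<^sup>2 / m n)"
  shows "summable (\<lambda>n. cmod (v n * k n))"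
    and "cmod (\<Sum>n. v n * k n) \<le>
      sqrt (\<Sum>n. m n * (cmod (v n))\<^sup>2) * sqrt (\<Sum>n. (cmod (k n))\<^sup>2 / m n)" (is "_ \<le> ?B")
proof -
  have v': "summable (\<lambda>n. m n * (cmod (v n))\<^sup>2)"
    using v by (simp add: ell2_def)
  have partial: "(\<Sum>n<N. cmod (v n * k n)) \<le> ?B" for N
  proof -
    have "(\<Sum>n<N. cmod (v n * k n)) = (\<Sum>n<N. \<bar>sqrt (m n) * cmod (v n)\<bar> * \<bar>cmod (k n) / sqrt (m n)\<bar>)"
      using pos by (intro sum.cong) (auto simp: norm_mult less_imp_le order_less_imp_not_eq2)
    also have "\<dots> \<le> L2_set (\<lambda>n. sqrt (m n) * cmod (v n)) {..<N} * L2_set (\<lambda>n. cmod (k n) / sqrt (m n)) {..<N}"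
      by (rule L2_set_mult_ineq)
    also have "\<dots> = sqrt (\<Sum>n<N. m n * (cmod (v n))\<^sup>2) * sqrt (\<Sum>n<N. (cmod (k n))\<^sup>2 / m n)"
      using pos by (simp add: L2_set_def power_mult_distrib power_divide less_imp_le)
    also have "\<dots> \<le> ?B"
      using pos by (intro mult_mono real_sqrt_le_mono sum_le_suminf v' k real_sqrt_ge_zero suminf_nonneg sum_nonneg)
        (auto simp: less_imp_le)
    finally show ?thesis .
  qed
  then show "summable (\<lambda>n. cmod (v n * k n))"
    by (intro summableI_nonneg_bounded[where x = ?B]) auto
  then show "cmod (\<Sum>n. v n * k n) \<le> ?B"
    using summable_norm[of "\<lambda>n. v n * k n"] suminf_le_const[OF _ partial] by fastforce
qed

section \<open>Lagrange kernels and interpolating series\<close>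

context sampling
begin

lemma S_t [simp]: "S (of_real (t n)) = 0"
  by (auto simp: S_zero)

lemma t_eq_iff [simp]: "t i = t j \<longleftrightarrow> i = j"
  using inj_t by (auto simp: inj_def)

text \<open>The fundamental function of Lagrange interpolation: the difference quotient of
  \<open>S\<close> at \<open>t n\<close>, normalised by the derivative. The value \<open>1\<close>
  at the node fills the removable singularity.\<close>

definition kernel :: "nat \<Rightarrow> complex \<Rightarrow> complex" where
  "kernel n z = (if z = of_real (t n) then 1
     else S z / (deriv S (of_real (t n)) * (z - of_real (t n))))"

lemma kernel_t: "kernel n (of_real (t k)) = (if k = n then 1 else 0)"
  by (simp add: kernel_def)

lemma kernel_holomorphic: "kernel n holomorphic_on UNIV"
proof -
  have "(\<lambda>z. inverse (deriv S (of_real (t n))) * (if z = of_real (t n) then deriv S (of_real (t n))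
      else (S z - S (of_real (t n))) / (z - of_real (t n)))) holomorphic_on UNIV"
    by (intro holomorphic_intros pole_lemma_open S_hol open_UNIV)
  also have "(\<lambda>z. inverse (deriv S (of_real (t n))) * (if z = of_real (t n) then deriv S (of_real (t n))
      else (S z - S (of_real (t n))) / (z - of_real (t n)))) = kernel n"
    using deriv_S[of n] by (auto simp: kernel_def fun_eq_iff field_simps)
  finally show ?thesis .
qed

text \<open>The derivative of \<open>S\<close> at a real node is real, since conjugating argument
  and value of \<open>S\<close> returns \<open>S\<close> but conjugates that derivative.\<close>

lemma kernel_cnj: "kernel n (cnj z) = cnj (kernel n z)"
proof -
  have "cnj (deriv S (of_real (t n))) = deriv S (of_real (t n))"
  proof -
    have S': "(S has_field_derivative deriv S (of_real (t n))) (at (of_real (t n)))"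
      using S_hol by (auto intro!: holomorphic_derivI)
    then have D: "((cnj \<circ> S \<circ> cnj) has_field_derivative cnj (deriv S (of_real (t n)))) (at (of_real (t n)))"
      by (intro has_field_derivative_cnj_cnj) simp
    have eq: "cnj \<circ> S \<circ> cnj = S"
      by (simp add: fun_eq_iff S_cnj)
    show ?thesis
      by (rule DERIV_unique[OF D[unfolded eq] S'])
  qed
  moreover have "cnj z = of_real (t n) \<longleftrightarrow> z = of_real (t n)"
    by (auto simp: complex_eq_iff)
  ultimately show ?thesis
    by (simp add: kernel_def S_cnj)
qed

text \<open>Once \<open>R + 1 \<le> \<bar>t n\<bar>\<close>, the node has distance at least
  \<open>1\<close> from the disc, and the kernel is controlled by a bound \<open>C\<close> for
  \<open>S\<close> on the disc.\<close>

lemma kernel_bound: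
  assumes "R > 0"
  obtains C where "C > 0"
    "\<forall>\<^sub>F n in sequentially. \<forall>z\<in>cball 0 R. cmod (kernel n z) \<le> C / cmod (deriv S (of_real (t n)))"
proof -
  have "compact (S ` cball 0 R)"
    by (intro compact_continuous_image compact_cball holomorphic_on_imp_continuous_on
        holomorphic_on_subset[OF S_hol] subset_UNIV)
  then obtain C where C: "C > 0" "\<And>z. z \<in> cball 0 R \<Longrightarrow> cmod (S z) \<le> C"
    using compact_imp_bounded bounded_pos by (metis imageI)
  have "\<forall>\<^sub>F n in sequentially. R + 1 \<le> \<bar>t n\<bar>"
    using filterlim_at_infinity_imp_norm_at_top[OF lim_t] by (simp add: filterlim_at_top)
  then have "\<forall>\<^sub>F n in sequentially. \<forall>z\<in>cball 0 R. cmod (kernel n z) \<le> C / cmod (deriv S (of_real (t n)))"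
  proof eventually_elim
    case (elim n)
    show ?case
    proof
      fix z :: complex assume z: "z \<in> cball 0 R"
      have "1 \<le> cmod (z - of_real (t n))"
        using norm_triangle_ineq2[of "complex_of_real (t n)" z] z elim by (simp add: norm_minus_commute)
      moreover from this have "z \<noteq> of_real (t n)"
        by auto
      ultimately have "cmod (kernel n z) =
          (cmod (S z) / cmod (deriv S (of_real (t n)))) * (1 / cmod (z - of_real (t n)))"
        by (simp add: kernel_def norm_divide norm_mult)
      also have "\<dots> \<le> C / cmod (deriv S (of_real (t n))) * 1"
        using C(2)[OF z] C(1) \<open>1 \<le> cmod (z - of_real (t n))\<close>
        by (intro mult_mono divide_right_mono) (auto simp: divide_simps)
      finally show "cmod (kernel n z) \<le> C / cmod (deriv S (of_real (t n)))"
        by simp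
    qed
  qed
  then show ?thesis
    using C(1) that by blast
qed

text \<open>The kernels at a fixed point are square-summable with the dual weights. This gives both
  the convergence of the interpolating series and the continuity of point evaluations.\<close>

lemma summable_kernel: "summable (\<lambda>n. (cmod (kernel n z))\<^sup>2 / m n)"
proof -
  obtain C where C: "C > 0"
    "\<forall>\<^sub>F n in sequentially. \<forall>z\<in>cball 0 (cmod z + 1). cmod (kernel n z) \<le> C / cmod (deriv S (of_real (t n)))"
    using kernel_bound[OF add_nonneg_pos[OF norm_ge_zero zero_less_one]] by blast
  show ?thesis
  proof (rule summable_comparison_test_ev)
    show "summable (\<lambda>n. C\<^sup>2 * (1 / (m n * (cmod (deriv S (of_real (t n))))\<^sup>2)))"
      by (intro summable_mult summable_S)
    show "\<forall>\<^sub>F n in sequentially. norm ((cmod (kernel n z))\<^sup>2 / m n) \<le>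
        C\<^sup>2 * (1 / (m n * (cmod (deriv S (of_real (t n))))\<^sup>2))"
      using C(2)
    proof eventually_elim
      case (elim n)
      then have "cmod (kernel n z) \<le> C / cmod (deriv S (of_real (t n)))"
        by auto
      then have "(cmod (kernel n z))\<^sup>2 / m n \<le> (C / cmod (deriv S (of_real (t n))))\<^sup>2 / m n"
        using m_pos[of n] by (intro divide_right_mono power_mono) auto
      then show ?case
        using m_pos[of n] by (simp add: power_divide mult.commute)
    qed
  qed
qed

definition interp :: "(nat \<Rightarrow> complex) \<Rightarrow> complex \<Rightarrow> complex" where
  "interp v z = (\<Sum>n. v n * kernel n z)"

lemma summable_interp: "v \<in> ell2 m \<Longrightarrow> summable (\<lambda>n. v n * kernel n z)"
  by (rule summable_norm_cancel) (rule ell2_Cauchy_Schwarz(1)[OF m_pos _ summable_kernel])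

text \<open>At a node only one kernel is non-zero, so the series is a finite sum. Sampling thus
  inverts \<open>interp\<close>.\<close>

lemma interp_t: "interp v (of_real (t k)) = v k"
proof -
  have "interp v (of_real (t k)) = (\<Sum>n\<in>{k}. v n * kernel n (of_real (t k)))"
    unfolding interp_def by (rule suminf_finite) (auto simp: kernel_t)
  then show ?thesis
    by (simp add: kernel_t)
qed

text \<open>On a disc the terms are eventually bounded by a constant times
  \<open>cmod (v n / deriv S (t n))\<close>, and these bounds are summable by Cauchy-Schwarz and
  \<open>summable_S\<close>.\<close>

lemma interp_holomorphic:
  assumes v: "v \<in> ell2 m"
  shows "interp v holomorphic_on UNIV"
proof -
  have "(\<lambda>z. \<Sum>n. v n * kernel n z) holomorphic_on UNIV"
  proof (rule holomorphic_on_suminf)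
    show "(\<lambda>z. v n * kernel n z) holomorphic_on UNIV" for n
      by (intro holomorphic_intros kernel_holomorphic)
    fix R :: real assume "R > 0"
    then obtain C where C: "C > 0"
      "\<forall>\<^sub>F n in sequentially. \<forall>z\<in>cball 0 R. cmod (kernel n z) \<le> C / cmod (deriv S (of_real (t n)))"
      using kernel_bound by blast
    have "summable (\<lambda>n. cmod (v n * inverse (deriv S (of_real (t n)))))"
      using summable_S
      by (intro ell2_Cauchy_Schwarz(1)[OF m_pos v]) (simp add: norm_inverse power_inverse inverse_eq_divide norm_divide power_divide mult.commute)
    then have "summable (\<lambda>n. C * cmod (v n * inverse (deriv S (of_real (t n)))))"
      by (rule summable_mult)
    moreover have "\<forall>\<^sub>F n in sequentially. \<forall>z\<in>cball 0 R.
        cmod (v n * kernel n z) \<le> C * cmod (v n * inverse (deriv S (of_real (t n))))"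
      using C(2)
    proof eventually_elim
      case (elim n)
      show ?case
      proof
        fix z :: complex assume "z \<in> cball 0 R"
        then have "cmod (v n) * cmod (kernel n z) \<le> cmod (v n) * (C / cmod (deriv S (of_real (t n))))"
          using elim by (intro mult_left_mono) auto
        then show "cmod (v n * kernel n z) \<le> C * cmod (v n * inverse (deriv S (of_real (t n))))"
          by (simp add: norm_mult norm_inverse norm_divide field_simps)
      qed
    qed
    ultimately show "\<exists>M. summable M \<and>
        (\<forall>\<^sub>F n in sequentially. \<forall>z\<in>cball 0 R. cmod (v n * kernel n z) \<le> M n)"
      by blast
  qed
  then show ?thesis
    by (simp add: interp_def[abs_def])
qed

lemma interp_lincomb:
  assumes "v \<in> ell2 m" "u \<in> ell2 m"
  shows "interp (\<lambda>n. a * v n + b * u n) z = a * interp v z + b * interp u z"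
  unfolding interp_def
  using suminf_add[OF summable_mult[OF summable_interp[OF assms(1)], of a z]
      summable_mult[OF summable_interp[OF assms(2)], of b z]]
  by (simp add: suminf_mult summable_interp assms algebra_simps)

lemma interp_cnj:
  assumes "v \<in> ell2 m"
  shows "cnj (interp v (cnj z)) = interp (\<lambda>n. cnj (v n)) z"
  using cnj_suminf[OF summable_interp[OF assms], of "cnj z"] by (simp add: interp_def kernel_cnj)

lemma interp_blaschke:
  assumes v: "v \<in> ell2 m" and w: "Im w \<noteq> 0" "interp v w = 0" and "z \<noteq> w"
  shows "interp (\<lambda>n. v n * ((of_real (t n) - cnj w) / (of_real (t n) - w))) z =
    interp v z * (z - cnj w) / (z - w)"
proof -
  have wt: "w \<noteq> of_real x" for x
    using w(1) by auto
  have Sw: "S w \<noteq> 0"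
    using wt by (auto simp: S_zero)
  \<comment> \<open>Partial fractions; the second part sums to a multiple of \<open>interp v w = 0\<close>.\<close>
  have termwise: "v n * ((of_real (t n) - cnj w) / (of_real (t n) - w)) * kernel n z =
      (z - cnj w) / (z - w) * (v n * kernel n z) -
      (w - cnj w) / (z - w) * S z / S w * (v n * kernel n w)" for n
  proof (cases "z = of_real (t n)")
    case True
    then show ?thesis
      by (simp add: kernel_def)
  next
    case False
    define x where "x = complex_of_real (t n)"
    define d where "d = deriv S x"
    have nz: "z - x \<noteq> 0" "w - x \<noteq> 0" "x - w \<noteq> 0" "z - w \<noteq> 0" "d \<noteq> 0"
      using False wt[of "t n"] \<open>z \<noteq> w\<close> deriv_S[of n] by (auto simp: x_def d_def)
    \<comment> \<open>Here \<open>P\<close>, \<open>p\<close> and \<open>q\<close> stand for the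
      Blaschke quotient at \<open>x\<close>, \<open>1 / (z - x)\<close> and
      \<open>1 / (w - x)\<close>. Their relation is multiplied by \<open>v n * S z / d\<close>;
      writing \<open>S z\<close> as \<open>S z / S w * S w\<close> in the last term produces the
      kernel at \<open>w\<close> with a factor independent of \<open>n\<close>.\<close>
    have regroup: "v n * P * (S z / d * p) =
        \<alpha> * (v n * (S z / d * p)) - \<beta> * S z / S w * (v n * (S w / d * q))"
      if "P * p = \<alpha> * p - \<beta> * q" for P p q \<alpha> \<beta>
    proof -
      have "v n * P * (S z / d * p) = v n * S z / d * (P * p)"
        by simp
      also have "\<dots> = v n * S z / d * (\<alpha> * p - \<beta> * q)"
        by (simp only: that)
      finally show ?thesis
        using Sw by (simp add: right_diff_distrib diff_divide_distrib mult_ac)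
    qed
    have "(x - cnj w) / (x - w) * (1 / (z - x)) =
        (z - cnj w) / (z - w) * (1 / (z - x)) - (w - cnj w) / (z - w) * (1 / (w - x))"
      using nz by (simp add: divide_simps) (simp add: algebra_simps)
    from regroup[OF this]
    have "v n * ((x - cnj w) / (x - w)) * (S z / d * (1 / (z - x))) =
        (z - cnj w) / (z - w) * (v n * (S z / d * (1 / (z - x)))) -
        (w - cnj w) / (z - w) * S z / S w * (v n * (S w / d * (1 / (w - x))))" .
    moreover have "kernel n z = S z / d * (1 / (z - x))" "kernel n w = S w / d * (1 / (w - x))"
      using False wt[of "t n"] by (simp_all add: kernel_def x_def d_def)
    ultimately show ?thesis
      by (simp only: x_def)
  qed
  have "(\<lambda>n. (z - cnj w) / (z - w) * (v n * kernel n z) -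
      (w - cnj w) / (z - w) * S z / S w * (v n * kernel n w)) sums
      ((z - cnj w) / (z - w) * interp v z - (w - cnj w) / (z - w) * S z / S w * interp v w)"
    unfolding interp_def by (intro sums_diff sums_mult summable_sums summable_interp v)
  then show ?thesis
    unfolding interp_def[of "\<lambda>n. v n * _ n"] termwise by (simp add: sums_iff w(2) mult.commute)
qed


section \<open>The space of interpolants and its inner product\<close>

definition samples :: "(complex \<Rightarrow> complex) \<Rightarrow> nat \<Rightarrow> complex" where
  "samples F n = F (of_real (t n))"

definition sampling_space :: "(complex \<Rightarrow> complex) set" where
  "sampling_space = interp ` ell2 m"

definition sampling_ip :: "(complex \<Rightarrow> complex) \<Rightarrow> (complex \<Rightarrow> complex) \<Rightarrow> complex" where
  "sampling_ip F G = (\<Sum>n. of_real (m n) * (samples F n * cnj (samples G n)))"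

lemma samples_interp [simp]: "samples (interp v) = v"
  by (simp add: samples_def interp_t fun_eq_iff)

lemma samples_mem: "F \<in> sampling_space \<Longrightarrow> samples F \<in> ell2 m"
  by (auto simp: sampling_space_def)

lemma interp_samples: "F \<in> sampling_space \<Longrightarrow> interp (samples F) = F"
  by (auto simp: sampling_space_def)

lemma interp_mem: "v \<in> ell2 m \<Longrightarrow> interp v \<in> sampling_space"
  by (simp add: sampling_space_def)

lemma interp_eqI: "v \<in> ell2 m \<Longrightarrow> F = interp v \<Longrightarrow> F \<in> sampling_space"
  by (simp add: interp_mem)

lemma lincomb_mem:
  assumes "F \<in> sampling_space" "G \<in> sampling_space"
  shows "(\<lambda>z. a * F z + b * G z) \<in> sampling_space"
proof (rule interp_eqI)
  show "(\<lambda>n. a * samples F n + b * samples G n) \<in> ell2 m"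
    by (intro ell2_lincomb m_pos samples_mem assms)
  show "(\<lambda>z. a * F z + b * G z) = interp (\<lambda>n. a * samples F n + b * samples G n)"
    by (simp add: fun_eq_iff interp_lincomb samples_mem interp_samples assms)
qed

lemma summable_sampling_ip:
  "F \<in> sampling_space \<Longrightarrow> G \<in> sampling_space \<Longrightarrow>
    summable (\<lambda>n. of_real (m n) * (samples F n * cnj (samples G n)))"
  by (intro ell2_summable_inner m_pos samples_mem)

lemma summable_norm_samples: "F \<in> sampling_space \<Longrightarrow> summable (\<lambda>n. m n * (cmod (samples F n))\<^sup>2)"
  using samples_mem by (simp add: ell2_def)

lemma sampling_ip_self:
  assumes "F \<in> sampling_space"
  shows "sampling_ip F F = of_real (\<Sum>n. m n * (cmod (samples F n))\<^sup>2)"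
  unfolding sampling_ip_def suminf_of_real[OF summable_norm_samples[OF assms]]
  by (simp only: of_real_mult complex_norm_square)

sublocale dB: entire_inner_product_space sampling_space sampling_ip
proof
  show "F holomorphic_on UNIV" if "F \<in> sampling_space" for F
    using that by (auto simp: sampling_space_def intro: interp_holomorphic)
  show "(\<lambda>z. 0) \<in> sampling_space"
    by (rule interp_eqI[of "\<lambda>n. 0"]) (auto simp: ell2_def interp_def)
  show "(\<lambda>z. F z + G z) \<in> sampling_space" if "F \<in> sampling_space" "G \<in> sampling_space" for F G
    using lincomb_mem[OF that, of 1 1] by simp
  show "(\<lambda>z. c * F z) \<in> sampling_space" if "F \<in> sampling_space" for F c
    using lincomb_mem[OF that that, of c 0] by simp
  show "sampling_ip (\<lambda>z. F z + G z) K = sampling_ip F K + sampling_ip G K"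
    if "F \<in> sampling_space" "G \<in> sampling_space" "K \<in> sampling_space" for F G K
    using suminf_add[OF summable_sampling_ip[OF that(1,3)] summable_sampling_ip[OF that(2,3)]]
    by (simp add: sampling_ip_def samples_def algebra_simps)
  show "sampling_ip (\<lambda>z. c * F z) G = c * sampling_ip F G"
    if "F \<in> sampling_space" "G \<in> sampling_space" for F G c
    using suminf_mult[OF summable_sampling_ip[OF that], of c]
    by (simp add: sampling_ip_def samples_def mult_ac)
  show "sampling_ip G F = cnj (sampling_ip F G)"
    if "F \<in> sampling_space" "G \<in> sampling_space" for F G
    unfolding sampling_ip_def cnj_suminf[OF summable_sampling_ip[OF that]] by (simp add: mult_ac)
  fix F assume F: "F \<in> sampling_space"
  have nonneg: "0 \<le> m n * (cmod (samples F n))\<^sup>2" for n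
    using m_pos[of n] by simp
  show "0 \<le> Re (sampling_ip F F)"
    unfolding sampling_ip_self[OF F] using suminf_nonneg[OF summable_norm_samples[OF F] nonneg] by simp
  assume "sampling_ip F F = 0"
  then have "(\<Sum>n. m n * (cmod (samples F n))\<^sup>2) = 0"
    unfolding sampling_ip_self[OF F] by simp
  then have "samples F n = 0" for n
    using suminf_eq_zero_iff[OF summable_norm_samples[OF F] nonneg] m_pos[of n]
    by (auto dest!: spec[of _ n])
  \<comment> \<open>Vanishing at all nodes does not force an entire function to vanish, as
    \<open>S\<close> shows; an element of the space, however, is the interpolant of its
    samples.\<close>
  then have "interp (samples F) = (\<lambda>z. 0)"
    by (simp add: interp_def fun_eq_iff)
  then show "F = (\<lambda>z. 0)"
    by (simp add: interp_samples F)
qed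

lemma sampling_norm_sums:
  "F \<in> sampling_space \<Longrightarrow> (\<lambda>n. m n * (cmod (samples F n))\<^sup>2) sums (ip_norm sampling_ip F)\<^sup>2"
  by (simp add: dB.ip_norm_sq sampling_ip_self summable_norm_samples summable_sums)

lemma sampling_norm_eq:
  "F \<in> sampling_space \<Longrightarrow> ip_norm sampling_ip F = sqrt (\<Sum>n. m n * (cmod (samples F n))\<^sup>2)"
  by (simp add: ip_norm_def sampling_ip_self)

lemma sampling_norm_interp:
  "v \<in> ell2 m \<Longrightarrow> ip_norm sampling_ip (interp v) = sqrt (\<Sum>n. m n * (cmod (v n))\<^sup>2)"
  by (simp add: sampling_norm_eq interp_mem)

lemma partial_sum_le_sampling_norm:
  assumes "F \<in> sampling_space"
  shows "(\<Sum>n<N. m n * (cmod (samples F n))\<^sup>2) \<le> (ip_norm sampling_ip F)\<^sup>2"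
  unfolding sums_unique[OF sampling_norm_sums[OF assms]]
  using m_pos by (intro sum_le_suminf summable_norm_samples assms) (auto simp: less_imp_le)

text \<open>A single term of the norm series is at most the whole. Hence the samples of a Cauchy
  sequence at a fixed node are Cauchy.\<close>

lemma samples_le_sampling_norm:
  assumes "F \<in> sampling_space"
  shows "sqrt (m n) * cmod (samples F n) \<le> ip_norm sampling_ip F"
proof (rule power2_le_imp_le)
  have "m n * (cmod (samples F n))\<^sup>2 \<le> (\<Sum>n<Suc n. m n * (cmod (samples F n))\<^sup>2)"
    using m_pos by (simp add: sum_nonneg less_imp_le)
  then show "(sqrt (m n) * cmod (samples F n))\<^sup>2 \<le> (ip_norm sampling_ip F)\<^sup>2"
    using partial_sum_le_sampling_norm[OF assms, of "Suc n"] m_pos[of n]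
    by (simp add: power_mult_distrib)
qed (simp add: dB.ip_norm_nonneg assms)

lemma sampling_evaluation_bound:
  assumes "F \<in> sampling_space"
  shows "cmod (F z) \<le> ip_norm sampling_ip F * sqrt (\<Sum>n. (cmod (kernel n z))\<^sup>2 / m n)"
  using ell2_Cauchy_Schwarz(2)[OF m_pos samples_mem[OF assms] summable_kernel]
  by (simp add: sampling_norm_eq assms interp_samples flip: interp_def)

section \<open>Completeness\<close>

text \<open>The samples converge at each node to some \<open>u\<close>. A uniform tail estimate
  shows that \<open>u\<close> is square-summable and that the convergence holds in norm, so
  \<open>interp u\<close> is the limit.\<close>

lemma sampling_space_complete: "dB.hmetric.mcomplete"
  unfolding dB.hmetric.mcomplete_def
proof (intro allI impI)
  fix \<sigma> assume "dB.hmetric.MCauchy \<sigma>"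
  then have \<sigma>: "\<sigma> j \<in> sampling_space"
    and Cauchy: "\<epsilon> > 0 \<Longrightarrow> \<exists>N. \<forall>i j. N \<le> i \<longrightarrow> N \<le> j \<longrightarrow> dB.hdist (\<sigma> i) (\<sigma> j) < \<epsilon>" for j \<epsilon>
    by (auto simp: dB.hmetric.MCauchy_def)
  define v where "v j = samples (\<sigma> j)" for j
  have hdist: "dB.hdist (\<sigma> i) (\<sigma> j) = ip_norm sampling_ip (\<lambda>z. \<sigma> i z - \<sigma> j z)" for i j
    by (simp add: dB.hdist_def \<sigma>)
  have samples_diff: "samples (\<lambda>z. \<sigma> i z - \<sigma> j z) n = v i n - v j n" for i j n
    by (simp add: samples_def v_def)
  have "Cauchy (\<lambda>j. v j n)" for n
  proof (rule metric_CauchyI)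
    fix e :: real assume "e > 0"
    then obtain N where N: "\<And>i j. N \<le> i \<Longrightarrow> N \<le> j \<Longrightarrow> dB.hdist (\<sigma> i) (\<sigma> j) < sqrt (m n) * e"
      using Cauchy[of "sqrt (m n) * e"] m_pos[of n] by auto
    have "dist (v i n) (v j n) < e" if "N \<le> i" "N \<le> j" for i j
    proof -
      have "sqrt (m n) * dist (v i n) (v j n) < sqrt (m n) * e"
        using samples_le_sampling_norm[OF dB.diff_mem[OF \<sigma>[of i] \<sigma>[of j]], of n] N[OF that]
        by (simp add: hdist samples_diff dist_norm)
      then show ?thesis
        using m_pos[of n] by simp
    qed
    then show "\<exists>M. \<forall>i\<ge>M. \<forall>j\<ge>M. dist (v i n) (v j n) < e"
      by blast
  qed
  then have "\<exists>l. (\<lambda>j. v j n) \<longlonglongrightarrow> l" for n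
    by (simp add: Cauchy_convergent_iff convergent_def)
  then obtain u where u: "\<And>n. (\<lambda>j. v j n) \<longlonglongrightarrow> u n"
    by metis
  \<comment> \<open>For each finite number \<open>K\<close> of terms, one index of the Cauchy
    estimate tends to infinity; the bound does not depend on \<open>K\<close> and so passes to the
    full series.\<close>
  have tail: "\<exists>N. \<forall>j\<ge>N. (\<lambda>n. v j n - u n) \<in> ell2 m \<and> (\<Sum>n. m n * (cmod (v j n - u n))\<^sup>2) \<le> e\<^sup>2"
    if e: "e > 0" for e
  proof -
    obtain N where N: "\<And>i j. N \<le> i \<Longrightarrow> N \<le> j \<Longrightarrow> dB.hdist (\<sigma> i) (\<sigma> j) < e"
      using Cauchy[OF e] by blast
    have partial: "(\<Sum>n<K. m n * (cmod (v j n - u n))\<^sup>2) \<le> e\<^sup>2" if "N \<le> j" for j K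
    proof (rule LIMSEQ_le_const2)
      show "(\<lambda>i. \<Sum>n<K. m n * (cmod (v j n - v i n))\<^sup>2) \<longlonglongrightarrow> (\<Sum>n<K. m n * (cmod (v j n - u n))\<^sup>2)"
        by (intro tendsto_intros u)
      have "(\<Sum>n<K. m n * (cmod (v j n - v i n))\<^sup>2) \<le> e\<^sup>2" if "N \<le> i" for i
      proof -
        have "(\<Sum>n<K. m n * (cmod (v j n - v i n))\<^sup>2) \<le> (dB.hdist (\<sigma> j) (\<sigma> i))\<^sup>2"
          using partial_sum_le_sampling_norm[OF dB.diff_mem[OF \<sigma>[of j] \<sigma>[of i]]]
          by (simp add: hdist samples_diff)
        also have "\<dots> \<le> e\<^sup>2"
          using N[OF \<open>N \<le> j\<close> that] by (intro power_mono dB.hmetric.nonneg) auto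
        finally show ?thesis .
      qed
      then show "\<exists>N. \<forall>i\<ge>N. (\<Sum>n<K. m n * (cmod (v j n - v i n))\<^sup>2) \<le> e\<^sup>2"
        by blast
    qed
    have "summable (\<lambda>n. m n * (cmod (v j n - u n))\<^sup>2)" if "N \<le> j" for j
      by (rule summableI_nonneg_bounded[OF _ partial[OF that]]) (simp add: m_pos less_imp_le)
    then show ?thesis
      using partial by (auto simp: ell2_def intro!: suminf_le_const)
  qed
  have "u \<in> ell2 m"
  proof -
    obtain j where j: "(\<lambda>n. v j n - u n) \<in> ell2 m"
      using tail[OF zero_less_one] by blast
    show ?thesis
      using ell2_lincomb[OF m_pos samples_mem[OF \<sigma>[of j]] j, of 1 "- 1"] by (simp add: v_def)
  qed
  have "limitin dB.hmetric.mtopology \<sigma> (interp u) sequentially"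
    unfolding dB.hmetric.limit_metric_sequentially
  proof (intro conjI allI impI)
    show mem: "interp u \<in> sampling_space"
      by (rule interp_mem) fact
    fix \<epsilon> :: real assume "\<epsilon> > 0"
    \<comment> \<open>Halving \<open>\<epsilon>\<close> turns the non-strict tail bound into a
      strict one.\<close>
    then obtain N where N: "\<And>j. N \<le> j \<Longrightarrow> (\<Sum>n. m n * (cmod (v j n - u n))\<^sup>2) \<le> (\<epsilon> / 2)\<^sup>2"
      using tail[of "\<epsilon> / 2"] by auto
    have "dB.hdist (\<sigma> j) (interp u) < \<epsilon>" if "N \<le> j" for j
    proof -
      have "dB.hdist (\<sigma> j) (interp u) = sqrt (\<Sum>n. m n * (cmod (v j n - u n))\<^sup>2)"
        using sampling_norm_eq[OF dB.diff_mem[OF \<sigma>[of j] mem]]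
        by (simp add: dB.hdist_def \<sigma> mem samples_def v_def interp_t)
      also have "\<dots> \<le> \<epsilon> / 2"
        using N[OF that] \<open>\<epsilon> > 0\<close> by (intro real_le_lsqrt) auto
      finally show ?thesis
        using \<open>\<epsilon> > 0\<close> by simp
    qed
    then show "\<exists>N. \<forall>j\<ge>N. \<sigma> j \<in> sampling_space \<and> dB.hdist (\<sigma> j) (interp u) < \<epsilon>"
      using \<sigma> by blast
  qed
  then show "\<exists>F. limitin dB.hmetric.mtopology \<sigma> F sequentially"
    by (rule exI[where x = "interp u"])
qed

section \<open>Blaschke quotients and the de Branges axioms\<close>

text \<open>For real \<open>x\<close> the numerator is the conjugate of the denominator.\<close>

lemma cmod_blaschke_real: "Im w \<noteq> 0 \<Longrightarrow> cmod ((of_real x - cnj w) / (of_real x - w)) = 1"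
proof -
  assume "Im w \<noteq> 0"
  then have "of_real x - w \<noteq> 0"
    by auto
  moreover have "of_real x - cnj w = cnj (of_real x - w)"
    by simp
  ultimately show ?thesis
    by (simp only: norm_divide complex_mod_cnj) simp
qed

text \<open>Away from \<open>w\<close> the two functions agree by \<open>interp_blaschke\<close>,
  and at \<open>w\<close> by continuity. The factors applied to the samples are unimodular, so
  membership and norm are preserved, which is \<open>H1\<close>.\<close>

lemma sampling_space_blaschke:
  assumes F: "F \<in> sampling_space" and w: "Im w \<noteq> 0" "F w = 0"
  defines "u \<equiv> \<lambda>n. samples F n * ((of_real (t n) - cnj w) / (of_real (t n) - w))"
  shows "remove_sings (\<lambda>z. F z * (z - cnj w) / (z - w)) = interp u" and "u \<in> ell2 m"
    and "cmod (u n) = cmod (samples F n)"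
proof -
  show norm_u: "cmod (u n) = cmod (samples F n)" for n
    by (simp only: u_def norm_mult cmod_blaschke_real[OF w(1)] mult_1_right)
  then show u: "u \<in> ell2 m"
    using samples_mem[OF F] by (simp add: ell2_def)
  let ?R = "remove_sings (\<lambda>z. F z * (z - cnj w) / (z - w))"
  have agree: "?R z = interp u z" if "z \<noteq> w" for z
    using interp_blaschke[OF samples_mem[OF F] w(1) _ that] w(2)
      remove_sings_blaschke(2)[OF dB.entire[OF F] w(2) that]
    by (simp add: interp_samples F u_def)
  have lim: "?R \<midarrow>w\<rightarrow> ?R w" "interp u \<midarrow>w\<rightarrow> interp u w"
    using remove_sings_blaschke(1)[OF dB.entire[OF F] w(2)] interp_holomorphic[OF u]
    by (auto dest!: holomorphic_on_imp_continuous_on simp: continuous_on_def)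
  have "\<forall>\<^sub>F z in at w. ?R z = interp u z"
    using agree by (simp add: eventually_at_filter)
  then have "?R \<midarrow>w\<rightarrow> interp u w"
    using lim(2) by (simp only: tendsto_cong)
  then have "?R w = interp u w"
    by (rule tendsto_unique[OF at_neq_bot lim(1)])
  then have "?R z = interp u z" for z
    using agree by (cases "z = w") simp_all
  then show "?R = interp u" ..
qed

lemma de_branges_sampling_space: "de_branges_space sampling_space sampling_ip"
proof
  show "dB.hmetric.mcomplete"
    by (rule sampling_space_complete)
  show "sampling_space \<noteq> {\<lambda>z. 0}"
  proof
    define e where "e n = (if n = 0 then 1 else 0 :: complex)" for n :: nat
    have "summable (\<lambda>n. m n * (cmod (e n))\<^sup>2)"
      by (rule summable_finite[of "{0}"]) (auto simp: e_def)
    then have "interp e \<in> sampling_space"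
      by (intro interp_mem) (simp add: ell2_def)
    moreover assume "sampling_space = {\<lambda>z. 0}"
    ultimately have "interp e (of_real (t 0)) = 0"
      by auto
    then show False
      by (simp add: interp_t e_def)
  qed
  show "remove_sings (\<lambda>z. F z * (z - cnj w) / (z - w)) \<in> sampling_space \<and>
      ip_norm sampling_ip (remove_sings (\<lambda>z. F z * (z - cnj w) / (z - w))) = ip_norm sampling_ip F"
    if "F \<in> sampling_space" "Im w \<noteq> 0" "F w = 0" for F w
    using sampling_space_blaschke[OF that] that(1)
    by (simp add: interp_mem sampling_norm_interp sampling_norm_eq)
  show "(\<lambda>z. cnj (F (cnj z))) \<in> sampling_space \<and>
      ip_norm sampling_ip (\<lambda>z. cnj (F (cnj z))) = ip_norm sampling_ip F"
    if F: "F \<in> sampling_space" for F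
  proof -
    have "(\<lambda>z. cnj (F (cnj z))) = interp (\<lambda>n. cnj (samples F n))"
      using interp_cnj[OF samples_mem[OF F]] by (simp add: interp_samples F fun_eq_iff)
    moreover have "(\<lambda>n. cnj (samples F n)) \<in> ell2 m"
      using samples_mem[OF F] by (simp add: ell2_def)
    ultimately show ?thesis
      using F by (simp add: interp_mem sampling_norm_interp sampling_norm_eq)
  qed
  show "continuous_map dB.hmetric.mtopology euclidean (\<lambda>F. F w)" for w
    unfolding mtopology_is_euclidean[symmetric] dB.hmetric.metric_continuous_map[OF Met_TC.Metric_space_axioms]
  proof (intro conjI ballI allI impI)
    fix F and \<epsilon> :: real assume F: "F \<in> sampling_space" and "\<epsilon> > 0"
    \<comment> \<open>Evaluation at \<open>w\<close> is Lipschitz with constant \<open>B\<close>;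
      \<open>B + 1\<close> is a denominator that \<open>B \<ge> 0\<close> makes positive.\<close>
    define B where "B = sqrt (\<Sum>n. (cmod (kernel n w))\<^sup>2 / m n)"
    have B: "B \<ge> 0"
      unfolding B_def by (intro real_sqrt_ge_zero suminf_nonneg summable_kernel) (simp add: m_pos less_imp_le)
    have "dist (F w) (G w) < \<epsilon>" if G: "G \<in> sampling_space" and d: "dB.hdist F G < \<epsilon> / (B + 1)" for G
    proof -
      have "dist (F w) (G w) \<le> dB.hdist F G * B"
        using sampling_evaluation_bound[OF dB.diff_mem[OF F G], of w]
        by (simp add: dist_norm dB.hdist_def F G B_def)
      also have "\<dots> \<le> dB.hdist F G * (B + 1)"
        by (intro mult_left_mono dB.hmetric.nonneg) auto
      also have "\<dots> < \<epsilon>"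
        using d B by (simp add: field_simps)
      finally show ?thesis .
    qed
    then show "\<exists>\<delta>>0. \<forall>G. G \<in> sampling_space \<and> dB.hdist F G < \<delta> \<longrightarrow> dist (F w) (G w) < \<epsilon>"
      using \<open>\<epsilon> > 0\<close> B by (intro exI[of _ "\<epsilon> / (B + 1)"]) auto
  qed auto
qed

section \<open>Independence of the enumeration\<close>

text \<open>The terms of the norm series are non-negative, so neither its convergence nor its sum
  changes under the permutation \<open>\<pi>\<close>.\<close>

lemma sampling_space_reindex:
  assumes "bij \<pi>"
  shows "\<And>F. F \<in> sampling_space \<Longrightarrow>
      (\<lambda>n. m (\<pi> n) * (cmod (F (of_real (t (\<pi> n)))))\<^sup>2) sums (ip_norm sampling_ip F)\<^sup>2"
    and "bij_betw (\<lambda>F n. F (of_real (t (\<pi> n)))) sampling_space (ell2 (\<lambda>n. m (\<pi> n)))"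
proof -
  have sums_reindex: "(\<lambda>n. m (\<pi> n) * (cmod (v (\<pi> n)))\<^sup>2) sums s \<longleftrightarrow> (\<lambda>n. m n * (cmod (v n))\<^sup>2) sums s"
    for v :: "nat \<Rightarrow> complex" and s
  proof -
    have nonneg: "m n * (cmod (v n))\<^sup>2 \<ge> 0" for n
      using m_pos[of n] by simp
    show ?thesis
      using has_sum_reindex_bij_betw[OF assms, of "\<lambda>n. m n * (cmod (v n))\<^sup>2" s]
        sums_nonneg_imp_has_sum[of "\<lambda>n. m n * (cmod (v n))\<^sup>2" s, OF _ nonneg]
        sums_nonneg_imp_has_sum[of "\<lambda>n. m (\<pi> n) * (cmod (v (\<pi> n)))\<^sup>2" s, OF _ nonneg]
      by (auto dest: has_sum_imp_sums)
  qed
  show "(\<lambda>n. m (\<pi> n) * (cmod (F (of_real (t (\<pi> n)))))\<^sup>2) sums (ip_norm sampling_ip F)\<^sup>2"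
    if "F \<in> sampling_space" for F
    using sampling_norm_sums[OF that] sums_reindex[of "samples F"] by (simp add: samples_def)
  have ell2_reindex: "(\<lambda>n. v (\<pi> n)) \<in> ell2 (\<lambda>n. m (\<pi> n)) \<longleftrightarrow> v \<in> ell2 m" for v
    unfolding ell2_def mem_Collect_eq summable_def using sums_reindex[of v] by blast
  show "bij_betw (\<lambda>F n. F (of_real (t (\<pi> n)))) sampling_space (ell2 (\<lambda>n. m (\<pi> n)))"
  \<comment> \<open>The inverse map first returns a sequence to the order of \<open>t\<close> and
    then interpolates it.\<close>
  proof (rule bij_betw_byWitness[where f' = "\<lambda>v. interp (\<lambda>n. v (inv \<pi> n))"])
    have [simp]: "\<pi> (inv \<pi> n) = n" "inv \<pi> (\<pi> n) = n" for n
      using assms by (simp_all add: bij_is_surj surj_f_inv_f bij_is_inj)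
    show "\<forall>F\<in>sampling_space. interp (\<lambda>n. F (of_real (t (\<pi> (inv \<pi> n))))) = F"
      using interp_samples by (simp add: samples_def[abs_def])
    show "\<forall>v\<in>ell2 (\<lambda>n. m (\<pi> n)). (\<lambda>n. interp (\<lambda>n. v (inv \<pi> n)) (of_real (t (\<pi> n)))) = v"
      by (simp add: interp_t)
    show "(\<lambda>F n. F (of_real (t (\<pi> n)))) ` sampling_space \<subseteq> ell2 (\<lambda>n. m (\<pi> n))"
      using samples_mem ell2_reindex[of "samples _"] by (auto simp: samples_def)
    show "(\<lambda>v. interp (\<lambda>n. v (inv \<pi> n))) ` ell2 (\<lambda>n. m (\<pi> n)) \<subseteq> sampling_space"
      using ell2_reindex[of "\<lambda>n. _ (inv \<pi> n)"] by (auto intro: interp_mem)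
  qed
qed

end

theorem theorem3:
  fixes \<mu> :: "real measure"
  assumes "\<mu> \<in> discrete_measures"
  shows "\<exists>H ip. de_branges_space H ip \<and> isometric_to_ell2 H ip \<mu>"
proof -
  obtain t :: "nat \<Rightarrow> real" where t: "bij_betw t UNIV (msupport \<mu>)"
    using ex_enumerates_support[OF assms] unfolding enumerates_support_def by blast
  define m where "m n = measure \<mu> {t n}" for n
  have inj: "inj t" and range: "range t = msupport \<mu>"
    using t by (auto simp: bij_betw_def)
  have lim: "filterlim t at_infinity sequentially"
    using inj assms by (intro filterlim_at_infinity_of_no_limit_points) (auto simp: range discrete_measures_def)
  \<comment> \<open>Since \<open>measure\<close> is \<open>0\<close> on sets of infinite mass,
    positivity uses both that the mass of the atom is positive and that it is finite.\<close>
  have pos: "m n > 0" for n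
    using assms range by (auto simp: m_def measure_def enn2real_positive_iff discrete_measures_def)
  obtain S where "sampling t m S"
    by (rule real_generating_function[of t m, OF inj lim pos])
  then interpret sampling t m S .
  have "isometric_to_ell2 sampling_space sampling_ip \<mu>"
    unfolding isometric_to_ell2_def
  proof (intro allI impI)
    fix t' assume "enumerates_support t' \<mu>"
    then have t': "bij_betw t' UNIV (msupport \<mu>)"
      by (simp add: enumerates_support_def)
    \<comment> \<open>The space is built from the fixed enumeration \<open>t\<close>;
      \<open>\<pi>\<close> is the permutation with \<open>t \<circ> \<pi> = t'\<close>.\<close>
    define \<pi> where "\<pi> = inv t \<circ> t'"
    have "bij \<pi>"
      unfolding \<pi>_def using bij_betw_trans[OF t' bij_betw_inv_into[OF t]] .
    moreover have "t (\<pi> n) = t' n" for n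
      unfolding \<pi>_def using t' range by (auto simp: bij_betw_def intro!: f_inv_into_f)
    ultimately show "(\<forall>F\<in>sampling_space. (\<lambda>n. measure \<mu> {t' n} * (cmod (F (of_real (t' n))))\<^sup>2)
          sums (ip_norm sampling_ip F)\<^sup>2) \<and>
        bij_betw (\<lambda>F n. F (of_real (t' n))) sampling_space (ell2 (\<lambda>n. measure \<mu> {t' n}))"
      using sampling_space_reindex[of \<pi>] by (simp add: m_def)
  qed
  then show ?thesis
    using de_branges_sampling_space by blast
qed

end
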